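(* Let $\mu$ be an arbitrary solution of the recursive distributional equation $$X_\varnothing\overset{d}{=}\gamma[\tau_\varnothing](X_1,X_2)$$ ($X_\varnothing$ with law $\mu$; $X_1,X_2$ copies of $X_\varnothing$ independent of each other and of the uniform $[0,1]$ variable $\tau_\varnothing$), and let $(\tau_{\mathbf i},X_{\mathbf i})_{\mathbf i\in\mathbb T}$ be the recursive tree process corresponding to the map $\gamma$ and $\mu$. Let $$X^\uparrow_{\mathbf i}:=\inf\big\{t\in[0,1]:\mathbf i\xrightarrow{\ \mathbb T^t\setminus\mathbb F\ }\infty\big\}\qquad(\mathbf i\in\mathbb T),\qquad\inf\emptyset:=\infty .$$ Then $X^\uparrow_\varnothing=X_\varnothing$ a.s. if and only if $\mu=\nu$, where $\nu$ is the probability measure on $[0,1]\cup\{\infty\}$ defined by $$\nu\big((t,1]\cup\{\infty\}\big):=1\wedge\frac1{2t}\qquad(t\in[0,1]).$$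
   Context: $\mathbb T$ is the set of all finite words $\mathbf i=i_1\cdots i_n$ ($n\ge0$) over the alphabet $\{1,2\}$, with $\varnothing$ the empty word; it is viewed as the rooted binary tree in which $\mathbf i$ has descendants $\mathbf i1,\mathbf i2$. A rooted subtree is a set $\mathbb U\subset\mathbb T$ closed under taking prefixes; its boundary is $\partial\mathbb U:=\{i_1\cdots i_n\in\mathbb T\setminus\mathbb U: n\ge1,\ i_1\cdots i_{n-1}\in\mathbb U\}$ if $\mathbb U\neq\emptyset$, and $\partial\emptyset:=\{\varnothing\}$. For $A\subset\mathbb T$, $\mathbf i\xrightarrow{A}\infty$ means there is a sequence $(\mathbf i_n)_{n\ge0}$ with $\mathbf i_0=\mathbf i$, each $\mathbf i_{n}$ ($n\geq 1$) obtained from $\mathbf i_{n-1}$ by appending one letter, and $\mathbf i_n\in A$ for all $n\ge0$. $I:=[0,1]\cup\{\infty\}$ and $\gamma:[0,1]\times I^2\to I$ is $\gamma[t](x,y):=x\wedge y$ if $x\wedge y>t$ and $:=\infty$ otherwise. The recursive tree process (RTP) corresponding to $\gamma$ and a solution $\mu$ of the equation is the collection $(\tau_{\mathbf i},X_{\mathbf i})_{\mathbf i\in\mathbb T}$, unique in law, such that $(\tau_{\mathbf i})_{\mathbf i\in\mathbb T}$ are i.i.d. uniform on $[0,1]$; for each finite rooted subtree $\mathbb U$, the variables $(X_{\mathbf i})_{\mathbf i\in\partial\mathbb U}$ are i.i.d. with law $\mu$ and independent of $(\tau_{\mathbf i})_{\mathbf i\in\mathbb U}$; and $X_{\mathbf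 i}=\gamma[\tau_{\mathbf i}](X_{\mathbf i1},X_{\mathbf i2})$ for all $\mathbf i\in\mathbb T$. $\mathbb T^t:=\{\mathbf i\in\mathbb T:\tau_{\mathbf i}\le t\}$ and $\mathbb F:=\{\mathbf i\in\mathbb T:\tau_{\mathbf i}\ge X_{\mathbf i1}\wedge X_{\mathbf i2}\}$. *)

theory Defs
  imports "HOL-Probability.Probability" "HOL-Library.Sublist"
begin

datatype letter = One | Two

instance letter :: countable
  by countable_datatype

instance letter :: finite
proof
  have "(UNIV :: letter set) = {One, Two}"
    using letter.exhaust by auto
  then show "finite (UNIV :: letter set)"
    by (metis finite.emptyI finite_insert)
qed

text \<open>A word is written from the root downwards: the children of \<open>i\<close> are
  \<open>i @ [One]\<close> and \<open>i @ [Two]\<close>.\<close>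

type_synonym tree_word = "letter list"

definition rooted_subtree :: "tree_word set \<Rightarrow> bool" where
  "rooted_subtree U \<longleftrightarrow> (\<forall>i\<in>U. \<forall>j. prefix j i \<longrightarrow> j \<in> U)"

definition tree_boundary :: "tree_word set \<Rightarrow> tree_word set" where
  "tree_boundary U = (if U = {} then {[]} else {i. i \<notin> U \<and> i \<noteq> [] \<and> butlast i \<in> U})"

definition path_to_infinity :: "tree_word set \<Rightarrow> tree_word \<Rightarrow> bool" where
  "path_to_infinity A i \<longleftrightarrow>
     (\<exists>s :: nat \<Rightarrow> tree_word. s 0 = i \<and> (\<forall>n. \<exists>a. s (Suc n) = s n @ [a]) \<and> (\<forall>n. s n \<in> A))"

definition I_set :: "ereal set" where
  "I_set = {0..1} \<union> {\<infinity>}"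

definition I_space :: "ereal measure" where
  "I_space = restrict_space borel I_set"

definition gamma_map :: "real \<Rightarrow> ereal \<Rightarrow> ereal \<Rightarrow> ereal" where
  "gamma_map t x y = (if min x y > ereal t then min x y else \<infinity>)"

definition unif01 :: "real measure" where
  "unif01 = uniform_measure lborel {0..1}"

definition law_on_I :: "ereal measure \<Rightarrow> bool" where
  "law_on_I \<mu> \<longleftrightarrow> prob_space \<mu> \<and> sets \<mu> = sets I_space"

text \<open>The left-hand side of the equation below is the law of \<open>\<gamma>[\<tau>](X\<^sub>1, X\<^sub>2)\<close> for
  independent \<open>\<tau>\<close> (uniform) and \<open>X\<^sub>1, X\<^sub>2\<close> (of law \<open>\<mu>\<close>).\<close>

definition RDE_solution :: "ereal measure \<Rightarrow> bool" where
  "RDE_solution \<mu> \<longleftrightarrow> law_on_I \<mu> \<and>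
     distr (unif01 \<Otimes>\<^sub>M (\<mu> \<Otimes>\<^sub>M \<mu>)) I_space (\<lambda>(t, x, y). gamma_map t x y) = \<mu>"

text \<open>Independence of the two families is stated for the \<open>\<sigma>\<close>-algebras they generate,
  since \<open>indep_var\<close> requires both variables to have the same type.\<close>

definition recursive_tree_process ::
  "'a measure \<Rightarrow> ereal measure \<Rightarrow> (tree_word \<Rightarrow> 'a \<Rightarrow> real) \<Rightarrow> (tree_word \<Rightarrow> 'a \<Rightarrow> ereal) \<Rightarrow> bool"
where
  "recursive_tree_process M \<mu> \<tau> X \<longleftrightarrow>
     prob_space M \<and>
     (\<forall>i. X i \<in> measurable M I_space) \<and>
     prob_space.indep_vars M (\<lambda>_. borel) \<tau> UNIV \<and>
     (\<forall>i. distr M borel (\<tau> i) = unif01) \<and>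
     (\<forall>U. finite U \<and> rooted_subtree U \<longrightarrow>
        prob_space.indep_vars M (\<lambda>_. I_space) X (tree_boundary U) \<and>
        (\<forall>i\<in>tree_boundary U. distr M I_space (X i) = \<mu>) \<and>
        prob_space.indep_set M
          (sets (vimage_algebra (space M) (\<lambda>\<omega>. \<lambda>i\<in>tree_boundary U. X i \<omega>)
                   (\<Pi>\<^sub>M i\<in>tree_boundary U. I_space)))
          (sets (vimage_algebra (space M) (\<lambda>\<omega>. \<lambda>i\<in>U. \<tau> i \<omega>) (\<Pi>\<^sub>M i\<in>U. borel)))) \<and>
     (\<forall>i. AE \<omega> in M. X i \<omega> = gamma_map (\<tau> i \<omega>) (X (i @ [One]) \<omega>) (X (i @ [Two]) \<omega>))"

text \<open>The following sets depend on one realisation \<open>t\<close> of the times and \<open>x\<close> of the process.\<close>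

definition open_points :: "(tree_word \<Rightarrow> real) \<Rightarrow> real \<Rightarrow> tree_word set" where
  "open_points t s = {i. t i \<le> s}"

definition frozen_points :: "(tree_word \<Rightarrow> real) \<Rightarrow> (tree_word \<Rightarrow> ereal) \<Rightarrow> tree_word set" where
  "frozen_points t x = {i. ereal (t i) \<ge> min (x (i @ [One])) (x (i @ [Two]))}"

text \<open>In \<open>ereal\<close>, \<open>Inf {} = \<infinity>\<close>.\<close>

definition X_up :: "(tree_word \<Rightarrow> real) \<Rightarrow> (tree_word \<Rightarrow> ereal) \<Rightarrow> tree_word \<Rightarrow> ereal" where
  "X_up t x i =
     Inf (ereal ` {s \<in> {0..1}. path_to_infinity (open_points t s - frozen_points t x) i})"

text \<open>The tail is computed in \<open>ennreal\<close>, where \<open>1 / 0 = \<infinity>\<close>, so that its value at \<open>t = 0\<close>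
  is \<open>1\<close>.\<close>

definition has_nu_tails :: "ereal measure \<Rightarrow> bool" where
  "has_nu_tails N \<longleftrightarrow> law_on_I N \<and>
     (\<forall>t::real. 0 \<le> t \<and> t \<le> 1 \<longrightarrow> emeasure N ({ereal t<..1} \<union> {\<infinity>}) = min 1 (1 / ennreal (2 * t)))"

definition nu :: "ereal measure" where
  "nu = (THE N. has_nu_tails N)"

lemma I_set_borel [measurable]: "I_set \<in> sets borel"
  unfolding I_set_def by measurable

lemma space_I_space [simp]: "space I_space = I_set"
  by (simp add: I_space_def space_restrict_space)

lemma tail_set_eq:
  assumes "0 \<le> t"
  shows "{ereal t<..1} \<union> {\<infinity>} = I_set \<inter> {ereal t<..}"
proof -
  have "0 \<le> x" if "ereal t < x" for x
    using assms that by (metis ereal_less_eq(5) less_le order.trans)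
  then show ?thesis
    by (auto simp: I_set_def)
qed

lemma gamma_map_measurable:
  assumes "sets \<mu> = sets I_space"
  shows "(\<lambda>(t, x, y). gamma_map t x y) \<in> measurable (unif01 \<Otimes>\<^sub>M (\<mu> \<Otimes>\<^sub>M \<mu>)) I_space"
proof -
  have eq: "sets (unif01 \<Otimes>\<^sub>M (\<mu> \<Otimes>\<^sub>M \<mu>)) = sets (borel \<Otimes>\<^sub>M (I_space \<Otimes>\<^sub>M I_space))"
    using assms by (intro sets_pair_measure_cong) (simp_all add: unif01_def)
  have [measurable]: "(\<lambda>x. x) \<in> borel_measurable I_space"
    unfolding I_space_def by (rule measurable_restrict_space1) simp
  have "(\<lambda>(t, x, y). gamma_map t x y) \<in> borel_measurable (borel \<Otimes>\<^sub>M (I_space \<Otimes>\<^sub>M I_space))"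
    unfolding gamma_map_def by measurable
  moreover have "(\<lambda>(t, x, y). gamma_map t x y) \<in> space (borel \<Otimes>\<^sub>M (I_space \<Otimes>\<^sub>M I_space)) \<rightarrow> I_set"
    by (auto simp: space_pair_measure gamma_map_def min_def I_set_def)
  ultimately have "(\<lambda>(t, x, y). gamma_map t x y) \<in> measurable (borel \<Otimes>\<^sub>M (I_space \<Otimes>\<^sub>M I_space)) I_space"
    unfolding I_space_def by (intro measurable_restrict_space2) auto
  then show ?thesis
    by (simp add: measurable_cong_sets[OF eq refl])
qed

lemma sets_I_space_rays:
  "sets I_space = sigma_sets I_set ((\<inter>) I_set ` range greaterThan)"
proof -
  have "sets (borel :: ereal measure) = sigma_sets UNIV (range greaterThan)"
    by (subst borel_Ioi) simp
  then have "sets I_space = (\<inter>) I_set ` sigma_sets UNIV (range greaterThan)"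
    by (simp add: I_space_def sets_restrict_space)
  also have "\<dots> = sigma_sets I_set ((\<inter>) I_set ` range greaterThan)"
  proof -
    have "I_set \<in> sigma_sets UNIV (range greaterThan)"
      using I_set_borel \<open>sets (borel :: ereal measure) = _\<close> by simp
    from sigma_sets_Int[OF this] show ?thesis
      by simp
  qed
  finally show ?thesis .
qed

lemma has_nu_tails_unique:
  assumes "has_nu_tails N" "has_nu_tails N'"
  shows "N = N'"
proof (rule measure_eqI_generator_eq
    [where E = "(\<inter>) I_set ` range greaterThan" and \<Omega> = I_set and A = "\<lambda>_. I_set"])
  let ?E = "(\<inter>) I_set ` range greaterThan"
  interpret N: prob_space N using assms(1) by (simp add: has_nu_tails_def law_on_I_def)
  interpret N': prob_space N' using assms(2) by (simp add: has_nu_tails_def law_on_I_def)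
  show sN: "sets N = sigma_sets I_set ?E" and sN': "sets N' = sigma_sets I_set ?E"
    using assms by (simp_all add: has_nu_tails_def law_on_I_def sets_I_space_rays)
  have spN: "space N = I_set" and spN': "space N' = I_set"
    using assms by (auto simp: has_nu_tails_def law_on_I_def dest!: sets_eq_imp_space_eq)
  show "Int_stable ?E"
  proof (rule Int_stableI)
    fix A B assume "A \<in> ?E" "B \<in> ?E"
    then obtain a b where "A = I_set \<inter> {a<..}" "B = I_set \<inter> {b<..}" by auto
    then have "A \<inter> B = I_set \<inter> {max a b<..}" by auto
    then show "A \<inter> B \<in> ?E" by blast
  qed
  show "?E \<subseteq> Pow I_set" by auto
  have "I_set = I_set \<inter> {-\<infinity><..}" by (auto simp: I_set_def)
  then show "range (\<lambda>_. I_set) \<subseteq> ?E" by blast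
  show "(\<Union>i::nat. I_set) = I_set" by simp
  show "emeasure N I_set \<noteq> \<infinity>" by simp
  fix A assume "A \<in> ?E"
  then obtain a where A: "A = I_set \<inter> {a<..}" by auto
  consider "a < 0" | s where "a = ereal s" "0 \<le> s" "s \<le> 1" | "1 < a" "a < \<infinity>" | "a = \<infinity>"
    by (cases a) (auto simp: not_less, meson not_le)
  then show "emeasure N A = emeasure N' A"
  proof cases
    case 1
    then have "A = I_set" by (auto simp: A I_set_def)
    then show ?thesis
      using N.emeasure_space_1 N'.emeasure_space_1 by (simp add: spN spN')
  next
    case 2
    then have "A = {ereal s<..1} \<union> {\<infinity>}"
      using tail_set_eq[of s] by (simp add: A)
    then show ?thesis using assms 2 by (simp add: has_nu_tails_def)
  next
    case 3
    then have "A = {ereal 1<..1} \<union> {\<infinity>}"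
    proof -
      have "A = {\<infinity>}"
        using 3 by (auto simp: A I_set_def)
      then show ?thesis by simp
    qed
    moreover have "emeasure N ({ereal 1<..1} \<union> {\<infinity>}) = emeasure N' ({ereal 1<..1} \<union> {\<infinity>})"
    proof -
      have "emeasure K ({ereal 1<..1} \<union> {\<infinity>}) = min 1 (1 / ennreal (2 * 1))"
        if "has_nu_tails K" for K
      proof -
        have "\<forall>t::real. 0 \<le> t \<and> t \<le> 1 \<longrightarrow> emeasure K ({ereal t<..1} \<union> {\<infinity>}) = min 1 (1 / ennreal (2 * t))"
          using that unfolding has_nu_tails_def by (rule conjunct2)
        from spec[OF this, of 1] show ?thesis
          by (rule mp) simp
      qed
      from this[OF assms(1)] this[OF assms(2)] show ?thesis by (simp only:)
    qed
    ultimately show ?thesis by (simp only:)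
  next
    case 4
    then have "A = {}" by (auto simp: A)
    then show ?thesis by simp
  qed
qed

lemma has_nu_tails_exists: "\<exists>N. has_nu_tails N"
proof -
  define f :: "real \<Rightarrow> ereal" where "f u = (if 1 / 2 \<le> u then ereal (1 / (2 * u)) else \<infinity>)" for u
  have sets_U [measurable_cong]: "sets unif01 = sets borel"
    by (simp add: unif01_def)
  interpret U: prob_space unif01
    unfolding unif01_def by (rule prob_space_uniform_measure) auto
  have f: "f \<in> measurable unif01 I_space"
    unfolding I_space_def
  proof (rule measurable_restrict_space2)
    show "f \<in> space unif01 \<rightarrow> I_set"
      by (auto simp: f_def I_set_def field_simps)
    show "f \<in> borel_measurable unif01"
      unfolding f_def by measurable
  qed
  have tail: "emeasure (distr unif01 I_space f) ({ereal t<..1} \<union> {\<infinity>}) = min 1 (1 / ennreal (2 * t))"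
    if t: "0 \<le> t" "t \<le> 1" for t
  proof -
    have "{ereal t<..1} \<union> {\<infinity>} \<in> sets I_space"
      unfolding tail_set_eq[OF t(1)] by (auto simp: I_space_def sets_restrict_space)
    then have "emeasure (distr unif01 I_space f) ({ereal t<..1} \<union> {\<infinity>}) =
        emeasure unif01 (f -` ({ereal t<..1} \<union> {\<infinity>}) \<inter> space unif01)"
      using f by (simp add: emeasure_distr)
    also have "f -` ({ereal t<..1} \<union> {\<infinity>}) \<inter> space unif01 = {u. t = 0 \<or> u < 1 / (2 * t)}"
    proof -
      have "f u \<in> {ereal t<..1} \<union> {\<infinity>} \<longleftrightarrow> t = 0 \<or> u < 1 / (2 * t)" for u
      proof (cases "1 / 2 \<le> u")
        case True
        then have u: "0 < 2 * u" by linarith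
        have le1: "1 / (2 * u) \<le> 1"
          unfolding pos_divide_le_eq[OF u] using True by linarith
        have "f u = ereal (1 / (2 * u))"
          using True unfolding f_def by (rule if_P)
        moreover have "ereal v \<in> {ereal t<..1} \<union> {\<infinity>} \<longleftrightarrow> t < v" if "v \<le> 1" for v
          using that by auto
        ultimately have "f u \<in> {ereal t<..1} \<union> {\<infinity>} \<longleftrightarrow> t < 1 / (2 * u)"
          using le1 by metis
        also have "\<dots> \<longleftrightarrow> t = 0 \<or> u < 1 / (2 * t)"
        proof (cases "t = 0")
          case True
          have "0 < 1 / (2 * u)" using u by (rule divide_pos_pos[OF zero_less_one])
          with True show ?thesis by blast
        next
          case False
          then have t2: "0 < 2 * t" using t by linarith
          have "t < 1 / (2 * u) \<longleftrightarrow> u < 1 / (2 * t)"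
            unfolding pos_less_divide_eq[OF u] pos_less_divide_eq[OF t2]
            by (simp only: mult.left_commute[of t 2 u] mult.left_commute[of u 2 t] mult.commute[of u t])
          with False show ?thesis by blast
        qed
        finally show ?thesis .
      next
        case False
        then have "t = 0 \<or> u < 1 / (2 * t)"
        proof (cases "t = 0")
          case False
          then have "1 / 2 \<le> 1 / (2 * t)" using t by (simp add: field_simps)
          then show ?thesis using \<open>\<not> 1 / 2 \<le> u\<close> by linarith
        qed simp
        then show ?thesis using False by (simp add: f_def)
      qed
      moreover have "space unif01 = UNIV" by (simp add: unif01_def)
      ultimately show ?thesis by (simp only: vimage_def Int_UNIV_right)
    qed
    also have "emeasure unif01 {u. t = 0 \<or> u < 1 / (2 * t)} = min 1 (1 / ennreal (2 * t))"
    proof (cases "t = 0")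
      case True
      then show ?thesis
        using U.emeasure_space_1 by (simp add: unif01_def)
    next
      case False
      then have t0: "0 < t" using t by simp
      have eq: "1 / ennreal (2 * t) = ennreal (1 / (2 * t))"
        using t0 by (subst ennreal_1[symmetric], subst divide_ennreal) auto
      have "emeasure unif01 {u. t = 0 \<or> u < 1 / (2 * t)} =
          emeasure lborel ({0..1} \<inter> {..<1 / (2 * t)})"
      proof -
        have "{u. t = 0 \<or> u < 1 / (2 * t)} = {..<1 / (2 * t)}"
          using t0 by (simp only: lessThan_def) simp
        moreover have "emeasure unif01 {..<c} = emeasure lborel ({0..1} \<inter> {..<c})" for c :: real
          by (simp add: unif01_def divide_ennreal_def)
        ultimately show ?thesis by (simp only:)
      qed
      also have "\<dots> = min 1 (ennreal (1 / (2 * t)))"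
      proof -
        have "emeasure lborel ({0..1} \<inter> {..<c}) = min 1 (ennreal c)" if "0 < c" for c :: real
        proof (cases "c \<le> 1")
          case True
          then have "{0..1} \<inter> {..<c} = {0..<c}" by auto
          with that True show ?thesis by (simp add: min_absorb2)
        next
          case False
          then have "{0..1} \<inter> {..<c} = {0..1}" by auto
          with False show ?thesis by (simp add: min_absorb1)
        qed
        moreover have "0 < 1 / (2 * t)" using t0 by simp
        ultimately show ?thesis by blast
      qed
      finally show ?thesis by (simp only: eq)
    qed
    finally show ?thesis .
  qed
  have "law_on_I (distr unif01 I_space f)"
    using U.prob_space_distr[OF f] by (simp add: law_on_I_def)
  moreover have "\<forall>t. 0 \<le> t \<and> t \<le> 1 \<longrightarrow>
      emeasure (distr unif01 I_space f) ({ereal t<..1} \<union> {\<infinity>}) = min 1 (1 / ennreal (2 * t))"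
    by (intro allI impI tail) (erule conjunct1, erule conjunct2)
  ultimately show ?thesis
    unfolding has_nu_tails_def by (intro exI conjI)
qed

lemma has_nu_tails_nu: "has_nu_tails nu"
proof -
  obtain N where N: "has_nu_tails N"
    using has_nu_tails_exists by blast
  show ?thesis
    unfolding nu_def by (rule theI[where P = has_nu_tails and a = N, OF N has_nu_tails_unique[OF _ N]])
qed

end

theory Submission
  imports Defs
begin

text \<open>Along a path of unfrozen points the values \<open>X\<close> are nondecreasing, and a finite value
  \<open>X\<^sub>i = v\<close> is passed on to some child with \<open>\<tau>\<^sub>i < v\<close>; hence \<open>X_up \<le> X\<close> always. So equality
  fails exactly when, for some \<open>s\<close>, with positive probability \<open>X > s\<close> at the root and an infinite
  path of unfrozen points open at \<open>s\<close> starts there. On \<open>X\<^sub>i > s\<close>, the point \<open>i\<close> is open and unfrozen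
  iff \<open>\<tau>\<^sub>i \<le> s\<close> and both children have values above \<open>s\<close>. With \<open>q = P(X > s)\<close>, this probability
  \<open>p\<close> is therefore the largest solution of \<open>p = s (q\<^sup>2 - (q - p)\<^sup>2)\<close> in \<open>[0, q]\<close>, which is \<open>0\<close> iff
  \<open>q \<le> 1 / (2 s)\<close>. Finally, every solution of the equation whose tail is at most \<open>1 / (2 s)\<close> for
  all \<open>s\<close> has the tail of \<open>\<nu>\<close>, because its jumps must cross the curve \<open>1 / (2 s)\<close>.\<close>

section \<open>Levels of the tree and cylinder events\<close>

text \<open>Levels are the boundaries to which the defining independence is applied. At
  \<open>N = 0\<close> the subtree is empty, and the convention for its boundary supplies the
  root.\<close>

lemma tree_boundary_level: "tree_boundary {i. length i < N} = {i. length i = N}"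
proof (cases N)
  case (Suc n)
  then have "{i :: tree_word. length i < N} \<noteq> {}"
    by (auto intro: exI[of _ "[]"])
  with Suc show ?thesis
    by (auto simp: tree_boundary_def)
qed (auto simp: tree_boundary_def)

lemma finite_words_below: "finite {i :: tree_word. length i < N}"
  by (rule finite_subset[OF _ finite_lists_length_le[of UNIV N]]) auto

lemma rooted_subtree_words_below: "rooted_subtree {i. length i < N}"
  by (auto simp: rooted_subtree_def dest: prefix_length_le)

lemma measurable_I_space_borel [measurable]: "(\<lambda>x. x) \<in> borel_measurable I_space"
  unfolding I_space_def by (rule measurable_restrict_space1) simp

text \<open>Supplies the events on which the independence of values and times, stated for generated
  \<sigma>-algebras, is evaluated.\<close>

lemma vimage_algebra_coordinates:
  assumes "J \<subseteq> K" "finite J" "\<And>j. j \<in> J \<Longrightarrow> B j \<in> sets N"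
    and Y: "\<And>j. Y j \<in> measurable M N"
  shows "{\<omega> \<in> space M. \<forall>j\<in>J. Y j \<omega> \<in> B j} \<in>
    sets (vimage_algebra (space M) (\<lambda>\<omega>. \<lambda>i\<in>K. Y i \<omega>) (\<Pi>\<^sub>M i\<in>K. N))"
proof -
  let ?S = "{f \<in> space (\<Pi>\<^sub>M i\<in>K. N). \<forall>j\<in>J. f j \<in> B j}"
  have f: "(\<lambda>\<omega>. \<lambda>i\<in>K. Y i \<omega>) \<in> space M \<rightarrow> space (\<Pi>\<^sub>M i\<in>K. N)"
    using measurable_space[OF Y] by (auto simp: space_PiM)
  have "?S \<in> sets (\<Pi>\<^sub>M i\<in>K. N)"
  proof (rule sets.sets_Collect_finite_All)
    show "finite J" by fact
    fix j assume j: "j \<in> J"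
    then have "(\<lambda>f. f j) \<in> measurable (\<Pi>\<^sub>M i\<in>K. N) N"
      using assms(1) by (intro measurable_component_singleton) auto
    from measurable_sets[OF this assms(3)[OF j]]
    show "{f \<in> space (\<Pi>\<^sub>M i\<in>K. N). f j \<in> B j} \<in> sets (\<Pi>\<^sub>M i\<in>K. N)"
      by (simp add: vimage_def Int_def conj_commute)
  qed
  from in_vimage_algebra[OF this, of "\<lambda>\<omega>. \<lambda>i\<in>K. Y i \<omega>" "space M"]
  have "(\<lambda>\<omega>. \<lambda>i\<in>K. Y i \<omega>) -` ?S \<inter> space M \<in>
    sets (vimage_algebra (space M) (\<lambda>\<omega>. \<lambda>i\<in>K. Y i \<omega>) (\<Pi>\<^sub>M i\<in>K. N))" .
  also have "(\<lambda>\<omega>. \<lambda>i\<in>K. Y i \<omega>) -` ?S \<inter> space M = {\<omega> \<in> space M. \<forall>j\<in>J. Y j \<omega> \<in> B j}"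
    using f assms(1) by (auto simp: subset_eq)
  finally show ?thesis .
qed

section \<open>Recursion from a finite level\<close>

text \<open>The value at \<open>i\<close> obtained by running the recursion upwards from level \<open>N\<close>, where \<open>z\<close>
  holds the values of the process at level \<open>N\<close> and the times at smaller levels.\<close>

function fill :: "nat \<Rightarrow> (tree_word \<Rightarrow> ereal) \<Rightarrow> tree_word \<Rightarrow> ereal" where
  "fill N z i = (if N \<le> length i then z i
     else gamma_map (real_of_ereal (z i)) (fill N z (i @ [One])) (fill N z (i @ [Two])))"
  by auto
termination by (relation "Wellfounded.measure (\<lambda>(N, z, i). N - length i)") auto

declare fill.simps [simp del]

text \<open>Given the recursion for \<open>x\<close>, this says that \<open>x i > s\<close> and that a path of \<open>n\<close> points
  that are open at \<open>s\<close> and not frozen starts at \<open>i\<close>.\<close>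

fun reach :: "real \<Rightarrow> nat \<Rightarrow> tree_word \<Rightarrow> (tree_word \<Rightarrow> real) \<Rightarrow> (tree_word \<Rightarrow> ereal) \<Rightarrow> bool" where
  "reach s 0 i t x \<longleftrightarrow> ereal s < x i"
| "reach s (Suc n) i t x \<longleftrightarrow> t i \<le> s \<and> ereal s < x (i @ [One]) \<and> ereal s < x (i @ [Two]) \<and>
     (reach s n (i @ [One]) t x \<or> reach s n (i @ [Two]) t x)"

definition subtree :: "nat \<Rightarrow> tree_word \<Rightarrow> tree_word set" where
  "subtree N i = {j. prefix i j \<and> length j \<le> N}"

lemma subtree_refl: "length i \<le> N \<Longrightarrow> i \<in> subtree N i"
  by (simp add: subtree_def)

lemma subtree_child: "subtree N (i @ [a]) \<subseteq> subtree N i"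
  by (auto simp: subtree_def dest: append_prefixD)

lemma subtree_disjoint:
  "i \<notin> subtree N (i @ [a])" "a \<noteq> b \<Longrightarrow> subtree N (i @ [a]) \<inter> subtree N (i @ [b]) = {}"
  by (auto simp: subtree_def prefix_def)

text \<open>Induction on the distance \<open>n\<close> of \<open>i\<close> from level
  \<open>N\<close>. Together with measurability, this makes the values at points with disjoint
  subtrees functions of disjoint blocks of coordinates.\<close>

lemma fill_restrict:
  "length i + n = N \<Longrightarrow> subtree N i \<subseteq> K \<Longrightarrow> fill N (restrict z K) i = fill N z i"
proof (induction n arbitrary: i)
  case 0
  then show ?case using subtree_refl[of i N] by (subst (1 2) fill.simps) auto
next
  case (Suc n)
  have "fill N (restrict z K) (i @ [a]) = fill N z (i @ [a])" for a
    using Suc.prems subtree_child[of N i a] by (intro Suc.IH) auto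
  moreover have "i \<in> K" using Suc.prems subtree_refl[of i N] by auto
  ultimately show ?case by (subst (1 2) fill.simps) simp
qed

lemma fill_measurable:
  "length i + n = N \<Longrightarrow> subtree N i \<subseteq> K \<Longrightarrow> (\<lambda>z. fill N z i) \<in> borel_measurable (PiM K (\<lambda>_. borel))"
proof (induction n arbitrary: i)
  case 0
  then have "i \<in> K" using subtree_refl[of i N] by auto
  then show ?case using 0 by (subst fill.simps) simp
next
  case (Suc n)
  have [measurable]: "(\<lambda>z. fill N z (i @ [a])) \<in> borel_measurable (PiM K (\<lambda>_. borel))" for a
    using Suc.prems subtree_child[of N i a] by (intro Suc.IH) auto
  have "i \<in> K" using Suc.prems subtree_refl[of i N] by auto
  then have [measurable]: "(\<lambda>z. z i) \<in> borel_measurable (PiM K (\<lambda>_. borel))"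
    by simp
  show ?case using Suc.prems by (subst fill.simps) (simp add: gamma_map_def)
qed

lemma reach_restrict:
  "length i + n = N \<Longrightarrow> subtree N i \<subseteq> K \<Longrightarrow>
   reach s n i (\<lambda>j. real_of_ereal (restrict z K j)) (fill N (restrict z K)) =
   reach s n i (\<lambda>j. real_of_ereal (z j)) (fill N z)"
proof (induction n arbitrary: i)
  case 0
  then show ?case using fill_restrict[of i 0 N K z] by (simp only: reach.simps)
next
  case (Suc n)
  have "reach s n (i @ [a]) (\<lambda>j. real_of_ereal (restrict z K j)) (fill N (restrict z K)) =
      reach s n (i @ [a]) (\<lambda>j. real_of_ereal (z j)) (fill N z)"
    and "fill N (restrict z K) (i @ [a]) = fill N z (i @ [a])" for a
    using Suc.prems subtree_child[of N i a] by (intro Suc.IH fill_restrict[of _ n]; auto)+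
  moreover have "i \<in> K" using Suc.prems subtree_refl[of i N] by auto
  ultimately show ?case by (simp only: reach.simps restrict_apply' if_True)
qed

lemma reach_fill_measurable:
  "length i + n = N \<Longrightarrow> subtree N i \<subseteq> K \<Longrightarrow>
   Measurable.pred (PiM K (\<lambda>_. borel)) (\<lambda>z. reach s n i (\<lambda>j. real_of_ereal (z j)) (fill N z))"
proof (induction n arbitrary: i)
  case 0
  have [measurable]: "(\<lambda>z. fill N z i) \<in> borel_measurable (PiM K (\<lambda>_. borel))"
    using 0 by (intro fill_measurable[of _ 0]) auto
  show ?case by simp
next
  case (Suc n)
  have [measurable]: "(\<lambda>z. fill N z (i @ [a])) \<in> borel_measurable (PiM K (\<lambda>_. borel))"
    "Measurable.pred (PiM K (\<lambda>_. borel)) (\<lambda>z. reach s n (i @ [a]) (\<lambda>j. real_of_ereal (z j)) (fill N z))" for a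
    using Suc.prems subtree_child[of N i a] by (intro Suc.IH fill_measurable[of _ n]; auto)+
  have "i \<in> K" using Suc.prems subtree_refl[of i N] by auto
  then have [measurable]: "(\<lambda>z. z i) \<in> borel_measurable (PiM K (\<lambda>_. borel))"
    by simp
  show ?case by simp
qed

text \<open>The bound on \<open>length j\<close> is strict for times: on the last level
  \<open>reach\<close> reads values only, and there the coordinates will hold values instead of
  times.\<close>

lemma reach_cong:
  "(\<And>j. j \<in> subtree (length i + n) i \<Longrightarrow> length j < length i + n \<Longrightarrow> t j = t' j) \<Longrightarrow>
   (\<And>j. j \<in> subtree (length i + n) i \<Longrightarrow> x j = x' j) \<Longrightarrow>
   reach s n i t x = reach s n i t' x'"
proof (induction n arbitrary: i)
  case 0
  then show ?case using subtree_refl[of i "length i"] by simp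
next
  case (Suc n)
  have "reach s n (i @ [a]) t x = reach s n (i @ [a]) t' x'" "x (i @ [a]) = x' (i @ [a])" for a
    using Suc.prems subtree_child[of "length i + Suc n" i a] subtree_refl[of "i @ [a]" "length i + Suc n"]
    by (auto intro!: Suc.IH)
  moreover have "t i = t' i" using Suc.prems subtree_refl[of i "length i + Suc n"] by auto
  ultimately show ?case by simp
qed

section \<open>Infinite paths in one realisation\<close>

lemma path_to_infinityI:
  assumes step: "\<And>i. P i \<Longrightarrow> i \<in> A \<and> (\<exists>a. P (i @ [a]))" and "P i"
  shows "path_to_infinity A i"
proof -
  have "\<exists>f. \<forall>n. (P (f n) \<and> (n = 0 \<longrightarrow> f n = i)) \<and> (\<exists>a. f (Suc n) = f n @ [a])"
    by (rule dependent_nat_choice) (use assms in \<open>blast+\<close>)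
  then show ?thesis
    unfolding path_to_infinity_def using step by blast
qed

lemma path_to_infinity_mono: "path_to_infinity A i \<Longrightarrow> A \<subseteq> B \<Longrightarrow> path_to_infinity B i"
  unfolding path_to_infinity_def by blast

lemma open_points_mono: "s \<le> s' \<Longrightarrow> open_points t s \<subseteq> open_points t s'"
  by (auto simp: open_points_def)

context
  fixes t :: "tree_word \<Rightarrow> real" and x :: "tree_word \<Rightarrow> ereal"
  assumes rec: "\<And>i. x i = gamma_map (t i) (x (i @ [One])) (x (i @ [Two]))"
begin

lemma not_frozen_value:
  "i \<notin> frozen_points t x \<Longrightarrow> x i = min (x (i @ [One])) (x (i @ [Two]))"
  by (subst rec) (auto simp: frozen_points_def gamma_map_def not_le)

lemma finite_value:
  assumes "x i \<noteq> \<infinity>"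
  shows "i \<notin> frozen_points t x" "ereal (t i) < x i" "\<exists>a. x (i @ [a]) = x i"
proof -
  show nf: "i \<notin> frozen_points t x"
    using assms by (subst (asm) rec) (auto simp: frozen_points_def gamma_map_def min_def split: if_splits)
  then show "ereal (t i) < x i"
    using not_frozen_value[OF nf] by (auto simp: frozen_points_def min_def not_le)
  show "\<exists>a. x (i @ [a]) = x i"
    unfolding not_frozen_value[OF nf] by (auto simp: min_def)
qed

text \<open>Shows how \<open>reach\<close> encodes being unfrozen: the time is at most
  \<open>s\<close>, hence below the minimum over the children.\<close>

lemma value_gt:
  "t i \<le> s \<Longrightarrow> ereal s < x (i @ [One]) \<Longrightarrow> ereal s < x (i @ [Two]) \<Longrightarrow>
   i \<notin> frozen_points t x \<and> ereal s < x i"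
proof -
  assume *: "t i \<le> s" "ereal s < x (i @ [One])" "ereal s < x (i @ [Two])"
  then have "i \<notin> frozen_points t x"
    using order.strict_trans1[of "ereal (t i)" "ereal s"]
    by (auto simp: frozen_points_def not_le)
  with * not_frozen_value show ?thesis by simp
qed

lemma reach_value_gt: "reach s n i t x \<Longrightarrow> ereal s < x i"
  using value_gt by (cases n) auto

lemma reach_antimono: "m \<le> n \<Longrightarrow> reach s n i t x \<Longrightarrow> reach s m i t x"
proof (induction m arbitrary: n i)
  case 0
  then show ?case using reach_value_gt by simp
next
  case (Suc m)
  from Suc.prems obtain k where "n = Suc k" "m \<le> k"
    by (metis Suc_le_D Suc_le_mono)
  with Suc show ?case by auto
qed

text \<open>Values do not decrease along an unfrozen path, so they stay above \<open>s\<close> at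
  its points and at both children of each. The converse is Koenig's lemma: one of the two children
  survives at every depth. The condition \<open>ereal s < x i\<close> sets aside paths that exist
  because the value at \<open>i\<close> is at most \<open>s\<close>.\<close>

lemma path_iff_reach:
  "ereal s < x i \<and> path_to_infinity (open_points t s - frozen_points t x) i \<longleftrightarrow> (\<forall>n. reach s n i t x)"
proof
  assume *: "ereal s < x i \<and> path_to_infinity (open_points t s - frozen_points t x) i"
  then obtain f where f: "f 0 = i" "\<And>n. \<exists>a. f (Suc n) = f n @ [a]"
      "\<And>n. f n \<in> open_points t s - frozen_points t x"
    unfolding path_to_infinity_def by blast
  have gt: "ereal s < x (f n)" for n
  proof (induction n)
    case (Suc n)
    obtain a where "f (Suc n) = f n @ [a]" using f(2) by blast
    with Suc not_frozen_value[of "f n"] f(3)[of n] show ?case by (cases a) auto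
  qed (use * f in simp)
  have "reach s n (f m) t x" for n m
  proof (induction n arbitrary: m)
    case (Suc n)
    obtain a where a: "f (Suc m) = f m @ [a]" using f(2) by blast
    with Suc[of "Suc m"] gt[of m] not_frozen_value[of "f m"] f(3)[of m] show ?case
      by (cases a) (auto simp: open_points_def)
  qed (use gt in simp)
  from this[of _ 0] show "\<forall>n. reach s n i t x" using f(1) by simp
next
  assume *: "\<forall>n. reach s n i t x"
  have "path_to_infinity (open_points t s - frozen_points t x) i"
  proof (rule path_to_infinityI[where P = "\<lambda>i. \<forall>n. reach s n i t x"])
    fix i assume i: "\<forall>n. reach s n i t x"
    then have "reach s 1 i t x" by blast
    then have "i \<in> open_points t s - frozen_points t x"
      using value_gt[of i s] by (simp add: open_points_def)
    moreover have "\<exists>a. \<forall>n. reach s n (i @ [a]) t x"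
    proof (rule ccontr)
      assume "\<nexists>a. \<forall>n. reach s n (i @ [a]) t x"
      then obtain m n where "\<not> reach s m (i @ [One]) t x" "\<not> reach s n (i @ [Two]) t x"
        by blast
      \<comment> \<open>Survival is antitone in the depth, so both failures move to a common depth
        and contradict survival of \<open>i\<close> one step further.\<close>
      then have "\<not> reach s (max m n) (i @ [One]) t x" "\<not> reach s (max m n) (i @ [Two]) t x"
        using reach_antimono[of m "max m n"] reach_antimono[of n "max m n"] by auto
      with i[rule_format, of "Suc (max m n)"] show False by simp
    qed
    ultimately show "i \<in> open_points t s - frozen_points t x \<and> (\<exists>a. \<forall>n. reach s n (i @ [a]) t x)"
      by blast
  qed (rule *)
  with * reach_value_gt show "ereal s < x i \<and> path_to_infinity (open_points t s - frozen_points t x) i"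
    by blast
qed

lemma X_up_le:
  assumes "x i \<in> I_set"
  shows "X_up t x i \<le> x i"
proof (cases "x i = \<infinity>")
  case False
  with assms obtain v where v: "x i = ereal v" "0 \<le> v" "v \<le> 1"
    by (cases "x i") (auto simp: I_set_def)
  have "path_to_infinity (open_points t v - frozen_points t x) i"
  proof (rule path_to_infinityI[where P = "\<lambda>i. x i = ereal v"])
    fix i assume i: "x i = ereal v"
    with finite_value[of i] show "i \<in> open_points t v - frozen_points t x \<and> (\<exists>a. x (i @ [a]) = ereal v)"
      by (auto simp: open_points_def)
  qed (rule v)
  with v show ?thesis unfolding X_up_def by (intro Inf_lower) auto
qed simp

text \<open>By \<open>X_up_le\<close>, equality fails just when a path exists at some time in [0,1]
  below the value; \<open>path_iff_reach\<close> turns this into survival at all depths.\<close>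

lemma X_up_eq_iff:
  assumes "x i \<in> I_set"
  shows "X_up t x i = x i \<longleftrightarrow> (\<forall>s. 0 \<le> s \<longrightarrow> s \<le> 1 \<longrightarrow> \<not> (\<forall>n. reach s n i t x))"
proof
  assume eq: "X_up t x i = x i"
  show "\<forall>s. 0 \<le> s \<longrightarrow> s \<le> 1 \<longrightarrow> \<not> (\<forall>n. reach s n i t x)"
  proof (intro allI impI notI)
    fix s :: real assume s: "0 \<le> s" "s \<le> 1" and "\<forall>n. reach s n i t x"
    then have "ereal s < x i" "path_to_infinity (open_points t s - frozen_points t x) i"
      using path_iff_reach by blast+
    moreover from this s have "X_up t x i \<le> ereal s"
      unfolding X_up_def by (intro Inf_lower) auto
    ultimately show False using eq by simp
  qed
next
  assume *: "\<forall>s. 0 \<le> s \<longrightarrow> s \<le> 1 \<longrightarrow> \<not> (\<forall>n. reach s n i t x)"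
  have "x i \<le> X_up t x i"
    unfolding X_up_def
  proof (rule Inf_greatest, safe)
    fix s :: real assume "s \<in> {0..1}" "path_to_infinity (open_points t s - frozen_points t x) i"
    with * path_iff_reach[of s i] show "x i \<le> ereal s" by (auto simp: not_less)
  qed
  with X_up_le[of i] assms show "X_up t x i = x i" by simp
qed

text \<open>Reduces uncountably many times to countably many. A path open at \<open>s\<close> stays
  open later, and a rational between \<open>s\<close> and \<open>min 1 (x i)\<close> is still below
  the value; at \<open>s = 1\<close> there is no room, but 1 is rational.\<close>

lemma ex_rational_reach:
  assumes "0 \<le> s" "s \<le> 1" "\<forall>n. reach s n i t x"
  shows "\<exists>r :: rat. 0 \<le> real_of_rat r \<and> real_of_rat r \<le> 1 \<and> (\<forall>n. reach (of_rat r) n i t x)"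
proof (cases "s = 1")
  case True
  with assms show ?thesis by (intro exI[of _ 1]) simp
next
  case False
  have path: "ereal s < x i" "path_to_infinity (open_points t s - frozen_points t x) i"
    using assms(3) path_iff_reach by blast+
  have "ereal s < min 1 (x i)"
    using path(1) False assms by (simp add: one_ereal_def)
  from ereal_dense2[OF this] obtain u where u: "s < u" "ereal u < min 1 (x i)"
    by auto
  obtain r where r: "s < of_rat r" "of_rat r < u"
    using of_rat_dense[OF u(1)] by blast
  have "ereal (of_rat r) < min 1 (x i)"
    using r(2) u(2) by (metis less_ereal.simps(1) order.strict_trans)
  then have "ereal (of_rat r) < x i" "of_rat r \<le> (1 :: real)"
    by (auto simp: one_ereal_def)
  moreover have "path_to_infinity (open_points t (of_rat r) - frozen_points t x) i"
    using open_points_mono[of s "of_rat r" t] r(1)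
    by (intro path_to_infinity_mono[OF path(2)]) auto
  ultimately have "\<forall>n. reach (of_rat r) n i t x" using path_iff_reach by blast
  moreover have "0 \<le> real_of_rat r" using r(1) assms(1) by linarith
  ultimately show ?thesis using \<open>of_rat r \<le> (1 :: real)\<close> by blast
qed

end

section \<open>Survival recursion and its critical value\<close>

text \<open>The probabilities of \<open>reach s n i\<close> as functions of \<open>n\<close>, where \<open>q\<close> is the probability
  of \<open>X\<^sub>i > s\<close>.\<close>

fun survival :: "real \<Rightarrow> real \<Rightarrow> nat \<Rightarrow> real" where
  "survival s q 0 = q"
| "survival s q (Suc n) = s * (q\<^sup>2 - (q - survival s q n)\<^sup>2)"

text \<open>In the supercritical case the recursion stays above its positive fixed point
  \<open>2 * q - 1 / s\<close>.\<close>

lemma survival_bounds: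
  assumes "0 \<le> q" "q \<le> 1" "0 < s" "s \<le> 1"
  shows "2 * q - 1 / s \<le> survival s q n \<and> survival s q n \<le> q"
proof -
  have "1 \<le> 1 / s" using assms by simp
  then have le: "2 * q - 1 / s \<le> q" using assms by linarith
  show ?thesis
  proof (induction n)
    case 0
    with le show ?case by simp
  next
    case (Suc n)
    let ?v = "survival s q n"
    \<comment> \<open>The recursion map increases on arguments up to \<open>q\<close>, so it
      preserves the bound by its fixed point.\<close>
    have "(q - ?v)\<^sup>2 \<le> (q - (2 * q - 1 / s))\<^sup>2"
      using Suc by (intro power_mono) auto
    then have "s * (q\<^sup>2 - (q - (2 * q - 1 / s))\<^sup>2) \<le> s * (q\<^sup>2 - (q - ?v)\<^sup>2)"
      using assms by (intro mult_left_mono) auto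
    also have "s * (q\<^sup>2 - (q - (2 * q - 1 / s))\<^sup>2) = 2 * q - 1 / s"
      using assms by (simp add: field_simps power2_eq_square)
    finally have "2 * q - 1 / s \<le> survival s q (Suc n)" by simp
    moreover have "survival s q (Suc n) \<le> q"
    proof -
      have "s * (q\<^sup>2 - (q - ?v)\<^sup>2) \<le> s * q\<^sup>2" using assms by (intro mult_left_mono) auto
      also have "\<dots> \<le> 1 * q\<^sup>2" using assms by (intro mult_right_mono) auto
      also have "\<dots> \<le> q" using assms by (simp add: power2_eq_square mult_left_le)
      finally show ?thesis by simp
    qed
    ultimately show ?case by blast
  qed
qed

text \<open>The limit is a fixed point: \<open>s * p\<^sup>2 = (2 * s * q - 1) * p\<close>. For
  \<open>2 * s * q \<le> 1\<close> the two sides have opposite signs; otherwise the positive fixed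
  point bounds the limit from below.\<close>

lemma survival_limit_eq_0_iff:
  assumes "0 \<le> q" "q \<le> 1" "0 \<le> s" "s \<le> 1" and lim: "survival s q \<longlonglongrightarrow> p" and "0 \<le> p"
  shows "p = 0 \<longleftrightarrow> 2 * s * q \<le> 1"
proof
  assume "p = 0"
  show "2 * s * q \<le> 1"
  proof (cases "s = 0")
    case False
    then have "0 < s" using assms by simp
    have "2 * q - 1 / s \<le> p"
      using survival_bounds[OF assms(1,2) \<open>0 < s\<close> assms(4)]
      by (intro LIMSEQ_le_const[OF lim]) blast
    with \<open>p = 0\<close> \<open>0 < s\<close> show ?thesis by (simp add: field_simps)
  qed simp
next
  assume le: "2 * s * q \<le> 1"
  have "(\<lambda>n. survival s q (Suc n)) \<longlonglongrightarrow> s * (q\<^sup>2 - (q - p)\<^sup>2)"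
    unfolding survival.simps by (intro tendsto_intros lim)
  with LIMSEQ_Suc[OF lim] have "p = s * (q\<^sup>2 - (q - p)\<^sup>2)"
    using LIMSEQ_unique by blast
  then have eq: "s * p\<^sup>2 = (2 * s * q - 1) * p"
    by (simp add: algebra_simps power2_eq_square)
  also have "\<dots> \<le> 0" using le \<open>0 \<le> p\<close> by (simp add: mult_nonpos_nonneg)
  finally have "s * p\<^sup>2 = 0" using \<open>0 \<le> s\<close> by (intro order_antisym) auto
  \<comment> \<open>For \<open>s = 0\<close> the vanishing product says nothing about
    \<open>p\<close>, but \<open>eq\<close> then reads \<open>0 = - p\<close>.\<close>
  with eq show "p = 0" by auto
qed

section \<open>Tails below the critical curve\<close>

text \<open>Suppose that \<open>q t < 1 / (2 t)\<close>, and let \<open>\<sigma>\<close> be the infimum of the points at which \<open>q\<close>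
  takes the value \<open>q t\<close>. By the equation, \<open>q (\<sigma>-) + q (\<sigma>+) \<ge> 1 / \<sigma>\<close>; since \<open>q (\<sigma>-)\<close> is
  at most \<open>1 / (2 \<sigma>)\<close>, this makes \<open>q t\<close> at least \<open>1 / (2 \<sigma>)\<close>, a contradiction.\<close>

lemma tail_determined:
  fixes q :: "real \<Rightarrow> real"
  assumes mono: "\<And>r s. r \<le> s \<Longrightarrow> q s \<le> q r" and le1: "\<And>s. q s \<le> 1" and nonneg: "\<And>s. 0 \<le> q s"
    and neg: "q (-1) = 1"
    and RDE: "\<And>r s. r \<le> s \<Longrightarrow> 0 \<le> s \<Longrightarrow> s \<le> 1 \<Longrightarrow> q r - q s \<le> s * ((q r)\<^sup>2 - (q s)\<^sup>2)"
    and bound: "\<And>s. 0 \<le> s \<Longrightarrow> s \<le> 1 \<Longrightarrow> 2 * s * q s \<le> 1"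
  shows "q 0 = 1" and "0 < t \<Longrightarrow> t \<le> 1 \<Longrightarrow> q t = min 1 (1 / (2 * t))"
proof -
  have jump: "1 \<le> s * (q r + q s)" if "r \<le> s" "0 \<le> s" "s \<le> 1" "q r \<noteq> q s" for r s
  proof -
    have "0 < q r - q s" using mono[OF that(1)] that(4) by simp
    moreover have "(q r - q s) * 1 \<le> (q r - q s) * (s * (q r + q s))"
      using RDE[OF that(1-3)] by (simp add: algebra_simps power2_eq_square)
    ultimately show ?thesis by (simp only: mult_le_cancel_left_pos)
  qed
  \<comment> \<open>The value 1 at -1, left of the support, cannot drop before 1/2: a drop would
    force \<open>1 \<le> s * (1 + q s) \<le> 2 * s\<close>.\<close>
  have half: "q s = 1" if "0 \<le> s" "s < 1 / 2" for s
  proof (rule ccontr)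
    assume "q s \<noteq> 1"
    then have "1 \<le> s * (1 + q s)" using jump[of "-1" s] neg that by auto
    also have "\<dots> \<le> s * 2" using le1[of s] that by (intro mult_left_mono) auto
    finally show False using that by simp
  qed
  from half[of 0] show "q 0 = 1" by simp
  assume t: "0 < t" "t \<le> 1"
  have "q t \<le> 1 / (2 * t)" using bound[of t] t by (simp add: field_simps)
  moreover have "\<not> (q t < 1 \<and> q t < 1 / (2 * t))"
  proof
    assume lt: "q t < 1 \<and> q t < 1 / (2 * t)"
    define S where "S = {s. 0 \<le> s \<and> s \<le> t \<and> q s = q t}"
    define \<sigma> where "\<sigma> = Inf S"
    have S: "t \<in> S" "bdd_below S" using t by (auto simp: S_def intro!: bdd_belowI[of _ 0])
    have "1 / 2 \<le> \<sigma>"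
      unfolding \<sigma>_def
    proof (rule cInf_greatest)
      fix s assume "s \<in> S"
      then show "1 / 2 \<le> s" using half[of s] lt by (cases "s < 1 / 2") (auto simp: S_def)
    qed (use S in auto)
    moreover have "\<sigma> \<le> t" unfolding \<sigma>_def using S by (intro cInf_lower)
    ultimately have \<sigma>: "0 < \<sigma>" "\<sigma> \<le> t" by auto
    have "\<sigma> * q t \<le> t * q t" using \<sigma> nonneg by (intro mult_right_mono)
    also have "\<dots> < 1 / 2" using lt t by (simp add: field_simps)
    finally have \<sigma>q: "\<sigma> * q t < 1 / 2" .
    then have d\<sigma>: "0 < 1 - \<sigma> * q t" by linarith
    \<comment> \<open>One-sided limits are replaced by points \<open>r < \<sigma>\<close> and
      \<open>s \<in> S\<close>. Inserting \<open>r * q r \<le> 1 / 2\<close> into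
      \<open>jump\<close> bounds \<open>s\<close> from below; the infimum over \<open>s\<close> then
      bounds \<open>r\<close> in terms of \<open>\<sigma>\<close>.\<close>
    have *: "r \<le> (\<sigma> / 2) / (1 - \<sigma> * q t)" if r: "0 < r" "r < \<sigma>" for r
    proof -
      have "r \<notin> S" using r S(2) cInf_lower[of r S] by (auto simp: \<sigma>_def)
      then have ne: "q r \<noteq> q t" using r \<sigma> by (auto simp: S_def)
      have d: "0 < 1 / 2 + r * q t" using r nonneg[of t] by (simp add: add_pos_nonneg)
      have "r / (1 / 2 + r * q t) \<le> \<sigma>"
        unfolding \<sigma>_def
      proof (rule cInf_greatest)
        fix s assume s: "s \<in> S"
        then have "\<sigma> \<le> s" unfolding \<sigma>_def using S by (intro cInf_lower)
        then have "1 \<le> s * (q r + q t)" using jump[of r s] s r t ne by (auto simp: S_def)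
        then have "r * 1 \<le> r * (s * (q r + q t))" using r by (intro mult_left_mono) auto
        also have "\<dots> = s * (r * q r + r * q t)" by (simp add: algebra_simps)
        also have "\<dots> \<le> s * (1 / 2 + r * q t)"
          using bound[of r] r \<sigma> t s by (intro mult_left_mono) (auto simp: S_def)
        finally show "r / (1 / 2 + r * q t) \<le> s" using d by (simp add: pos_divide_le_eq)
      qed (use S in auto)
      then have "r \<le> \<sigma> * (1 / 2 + r * q t)" using d by (simp add: pos_divide_le_eq)
      then have "r * (1 - \<sigma> * q t) \<le> \<sigma> / 2" by (simp add: algebra_simps)
      then show ?thesis unfolding pos_le_divide_eq[OF d\<sigma>] .
    qed
    \<comment> \<open>Letting \<open>r\<close> increase to \<open>\<sigma>\<close> yields
      \<open>1 / 2 \<le> \<sigma> * q t\<close>, against \<open>\<sigma>q\<close>.\<close>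
    have "\<sigma> \<le> (\<sigma> / 2) / (1 - \<sigma> * q t)"
      by (rule dense_le_bounded[OF \<sigma>(1)]) (rule *)
    then have "\<sigma> * (1 - \<sigma> * q t) \<le> \<sigma> * (1 / 2)" unfolding pos_le_divide_eq[OF d\<sigma>] by simp
    then have "1 - \<sigma> * q t \<le> 1 / 2" using \<sigma>(1) by (simp only: mult_le_cancel_left_pos)
    then show False using \<sigma>q by linarith
  qed
  ultimately show "q t = min 1 (1 / (2 * t))" using le1[of t] by (auto simp: min_def not_less)
qed

section \<open>Independence in the recursive tree process\<close>

text \<open>Covers the empty index set, which \<open>indep_varsD\<close> excludes: a finite set of
  words may have no member on a given level, or none before it.\<close>

lemma (in prob_space) prob_Ball_indep:
  assumes "indep_vars (\<lambda>_. N) Y I" "J \<subseteq> I" "finite J" "\<And>j. j \<in> J \<Longrightarrow> B j \<in> sets N"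
  shows "prob {\<omega> \<in> space M. \<forall>j\<in>J. Y j \<omega> \<in> B j} = (\<Prod>j\<in>J. prob (Y j -` B j \<inter> space M))"
proof (cases "J = {}")
  case True
  then show ?thesis by (simp add: prob_space)
next
  case False
  have "{\<omega> \<in> space M. \<forall>j\<in>J. Y j \<omega> \<in> B j} = (\<Inter>j\<in>J. Y j -` B j \<inter> space M)"
    using False by auto
  then show ?thesis
    using indep_varsD[OF assms(1) False assms(3,2)] assms(4) by simp
qed

lemma nu_tail_eq:
  assumes "0 < s"
  shows "min 1 (1 / ennreal (2 * s)) = ennreal (min 1 (1 / (2 * s)))"
proof -
  have "1 / ennreal (2 * s) = ennreal (1 / (2 * s))"
    using assms by (subst ennreal_1[symmetric], subst divide_ennreal) auto
  then show ?thesis using assms by (simp add: min_def ennreal_le_1 not_le del: ennreal_1)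
qed

locale tree_process =
  fixes M :: "'a measure" and \<mu> :: "ereal measure"
    and \<tau> :: "tree_word \<Rightarrow> 'a \<Rightarrow> real" and X :: "tree_word \<Rightarrow> 'a \<Rightarrow> ereal"
  assumes rtp: "recursive_tree_process M \<mu> \<tau> X"
begin

sublocale prob_space M
  using rtp by (simp add: recursive_tree_process_def)

lemma X_measurable [measurable]: "X i \<in> measurable M I_space"
  using rtp by (simp add: recursive_tree_process_def)

lemma X_borel_measurable [measurable]: "X i \<in> borel_measurable M"
  using measurable_compose[OF X_measurable measurable_I_space_borel] .

lemma indep_\<tau>: "indep_vars (\<lambda>_. borel) \<tau> UNIV"
  using rtp by (simp add: recursive_tree_process_def)

lemma \<tau>_measurable [measurable]: "\<tau> i \<in> borel_measurable M"
  using indep_\<tau> by (simp add: indep_vars_def)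

lemma distr_\<tau>: "distr M borel (\<tau> i) = unif01"
  using rtp by (simp add: recursive_tree_process_def)

lemma
  shows indep_X_level: "indep_vars (\<lambda>_. I_space) X {i. length i = N}"
    and distr_X_level: "length i = N \<Longrightarrow> distr M I_space (X i) = \<mu>"
    and indep_X_\<tau>: "indep_set
          (sets (vimage_algebra (space M) (\<lambda>\<omega>. \<lambda>i\<in>{i. length i = N}. X i \<omega>)
                   (\<Pi>\<^sub>M i\<in>{i. length i = N}. I_space)))
          (sets (vimage_algebra (space M) (\<lambda>\<omega>. \<lambda>i\<in>{i. length i < N}. \<tau> i \<omega>)
                   (\<Pi>\<^sub>M i\<in>{i. length i < N}. borel)))"
proof -
  have "\<forall>U. finite U \<and> rooted_subtree U \<longrightarrow>
        indep_vars (\<lambda>_. I_space) X (tree_boundary U) \<and>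
        (\<forall>i\<in>tree_boundary U. distr M I_space (X i) = \<mu>) \<and>
        indep_set
          (sets (vimage_algebra (space M) (\<lambda>\<omega>. \<lambda>i\<in>tree_boundary U. X i \<omega>)
                   (\<Pi>\<^sub>M i\<in>tree_boundary U. I_space)))
          (sets (vimage_algebra (space M) (\<lambda>\<omega>. \<lambda>i\<in>U. \<tau> i \<omega>) (\<Pi>\<^sub>M i\<in>U. borel)))"
    using rtp unfolding recursive_tree_process_def by blast
  from this[rule_format, OF conjI, OF finite_words_below rooted_subtree_words_below, of N]
  show "indep_vars (\<lambda>_. I_space) X {i. length i = N}"
    and "length i = N \<Longrightarrow> distr M I_space (X i) = \<mu>"
    and "indep_set
          (sets (vimage_algebra (space M) (\<lambda>\<omega>. \<lambda>i\<in>{i. length i = N}. X i \<omega>)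
                   (\<Pi>\<^sub>M i\<in>{i. length i = N}. I_space)))
          (sets (vimage_algebra (space M) (\<lambda>\<omega>. \<lambda>i\<in>{i. length i < N}. \<tau> i \<omega>)
                   (\<Pi>\<^sub>M i\<in>{i. length i < N}. borel)))"
    unfolding tree_boundary_level by auto
qed

text \<open>There are countably many words, so outside one null set the lemmas on a single
  realisation apply.\<close>

lemma AE_X_recursion:
  "AE \<omega> in M. \<forall>i. X i \<omega> = gamma_map (\<tau> i \<omega>) (X (i @ [One]) \<omega>) (X (i @ [Two]) \<omega>)"
  unfolding AE_all_countable using rtp by (simp add: recursive_tree_process_def)

text \<open>The common type \<open>ereal\<close> lets times and level-\<open>N\<close> values form
  one independent family, from which \<open>fill\<close> almost surely recovers all values up to
  level \<open>N\<close>.\<close>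

definition inputs :: "nat \<Rightarrow> tree_word \<Rightarrow> 'a \<Rightarrow> ereal" where
  "inputs N i \<omega> = (if length i < N then ereal (\<tau> i \<omega>) else X i \<omega>)"

lemma inputs_measurable [measurable]: "inputs N i \<in> borel_measurable M"
  unfolding inputs_def[abs_def] by measurable

text \<open>A finite index set splits into words of length \<open>N\<close> and shorter ones. The
  two parts generate independent \<sigma>-algebras, and each part is itself an independent
  family.\<close>

lemma indep_inputs: "indep_vars (\<lambda>_. borel) (inputs N) {i. length i \<le> N}"
  unfolding indep_vars_def2 indep_sets_def
proof (intro conjI ballI allI impI)
  fix J A
  let ?F = "\<lambda>i. {inputs N i -` A \<inter> space M |A. A \<in> sets borel}"
  assume J: "J \<subseteq> {i :: tree_word. length i \<le> N}" "J \<noteq> {}" "finite J" and "A \<in> Pi J ?F"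
  then have "\<forall>j\<in>J. \<exists>B. A j = inputs N j -` B \<inter> space M \<and> B \<in> sets borel"
    by blast
  then obtain B where B: "\<And>j. j \<in> J \<Longrightarrow> A j = inputs N j -` B j \<inter> space M"
      "\<And>j. j \<in> J \<Longrightarrow> B j \<in> sets borel"
    by (metis (no_types, lifting))
  define J1 where "J1 = J \<inter> {i. length i = N}"
  define J2 where "J2 = J \<inter> {i. length i < N}"
  have sub: "J1 \<subseteq> {i. length i = N}" "J2 \<subseteq> {i. length i < N}" "J1 \<inter> J2 = {}" "J = J1 \<union> J2"
      "finite J1" "finite J2"
    using J by (auto simp: J1_def J2_def dest: le_neq_implies_less)
  define B1 where "B1 j = B j \<inter> I_set" for j
  define B2 where "B2 j = ereal -` B j" for j
  have B1: "B1 j \<in> sets I_space" if "j \<in> J1" for j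
    using B(2)[of j] that sub by (auto simp: I_space_def B1_def sets_restrict_space_iff)
  have B2: "B2 j \<in> sets borel" if "j \<in> J2" for j
    using measurable_sets_borel[OF borel_measurable_ereal[OF measurable_ident], of "B j"] B(2)[of j] that sub
    by (auto simp: B2_def)
  have X_in: "X j \<omega> \<in> I_set" if "\<omega> \<in> space M" for j \<omega>
    using measurable_space[OF X_measurable that] by simp
  have A1: "A j = X j -` B1 j \<inter> space M" if "j \<in> J1" for j
    using B(1)[of j] that sub X_in by (auto simp: inputs_def B1_def)
  have A2: "A j = \<tau> j -` B2 j \<inter> space M" if "j \<in> J2" for j
    using B(1)[of j] that sub by (auto simp: inputs_def B2_def)
  let ?E1 = "{\<omega> \<in> space M. \<forall>j\<in>J1. X j \<omega> \<in> B1 j}"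
  let ?E2 = "{\<omega> \<in> space M. \<forall>j\<in>J2. \<tau> j \<omega> \<in> B2 j}"
  have "(\<Inter>j\<in>J. A j) = ?E1 \<inter> ?E2"
    using A1 A2 sub(4) J(2) by auto
  also have "prob (?E1 \<inter> ?E2) = prob ?E1 * prob ?E2"
    by (intro indep_setD[OF indep_X_\<tau>[of N]] vimage_algebra_coordinates sub B1 B2
        X_measurable \<tau>_measurable) auto
  also have "prob ?E1 = (\<Prod>j\<in>J1. prob (A j))"
    using prob_Ball_indep[OF indep_X_level sub(1,5) B1] A1 by simp
  also have "prob ?E2 = (\<Prod>j\<in>J2. prob (A j))"
    using prob_Ball_indep[OF indep_\<tau> subset_UNIV sub(6) B2] A2 by simp
  also have "(\<Prod>j\<in>J1. prob (A j)) * (\<Prod>j\<in>J2. prob (A j)) = (\<Prod>j\<in>J. prob (A j))"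
    unfolding sub(4) using sub by (subst prod.union_disjoint) auto
  finally show "prob (\<Inter>j\<in>J. A j) = (\<Prod>j\<in>J. prob (A j))" .
qed (auto intro: measurable_sets)

lemma AE_fill_inputs: "AE \<omega> in M. \<forall>i. length i \<le> N \<longrightarrow> fill N (\<lambda>j. inputs N j \<omega>) i = X i \<omega>"
  using AE_X_recursion
proof eventually_elim
  case (elim \<omega>)
  have "length i + n = N \<Longrightarrow> fill N (\<lambda>j. inputs N j \<omega>) i = X i \<omega>" for n i
  proof (induction n arbitrary: i)
    case 0
    then show ?case by (subst fill.simps) (simp add: inputs_def)
  next
    case (Suc n)
    then show ?case using elim[rule_format, of i] by (subst fill.simps) (simp add: inputs_def)
  qed
  then show ?case by (metis le_add_diff_inverse)
qed

section \<open>Local events and their factorisation\<close>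

text \<open>The coordinates of the subtree decide \<open>P\<close> only almost surely, because the
  recursion recovering values from \<open>inputs\<close> holds only then. Measurability of
  \<open>P\<close> is asked separately, since almost sure equality does not imply it.\<close>

definition local_event :: "nat \<Rightarrow> tree_word \<Rightarrow> ('a \<Rightarrow> bool) \<Rightarrow> bool" where
  "local_event N i P \<longleftrightarrow> Measurable.pred M P \<and>
     (\<exists>B. Measurable.pred (PiM (subtree N i) (\<lambda>_. borel)) B \<and>
        (AE \<omega> in M. P \<omega> \<longleftrightarrow> B (\<lambda>j\<in>subtree N i. inputs N j \<omega>)))"

lemma local_eventI:
  assumes "Measurable.pred M P" "Measurable.pred (PiM (subtree N i) (\<lambda>_. borel)) B"
    "AE \<omega> in M. P \<omega> \<longleftrightarrow> B (\<lambda>j\<in>subtree N i. inputs N j \<omega>)"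
  shows "local_event N i P"
  using assms unfolding local_event_def by blast

lemma local_event_pred: "local_event N i P \<Longrightarrow> Measurable.pred M P"
  by (simp add: local_event_def)

lemma local_event_conj:
  assumes "local_event N i P" "local_event N i Q"
  shows "local_event N i (\<lambda>\<omega>. P \<omega> \<and> Q \<omega>)"
proof -
  obtain B C where BC: "Measurable.pred (PiM (subtree N i) (\<lambda>_. borel)) B"
      "Measurable.pred (PiM (subtree N i) (\<lambda>_. borel)) C"
      "AE \<omega> in M. P \<omega> \<longleftrightarrow> B (\<lambda>j\<in>subtree N i. inputs N j \<omega>)"
      "AE \<omega> in M. Q \<omega> \<longleftrightarrow> C (\<lambda>j\<in>subtree N i. inputs N j \<omega>)"
    using assms unfolding local_event_def by blast
  show ?thesis
  proof (rule local_eventI)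
    show "Measurable.pred M (\<lambda>\<omega>. P \<omega> \<and> Q \<omega>)"
      using assms[THEN local_event_pred] by measurable
    show "Measurable.pred (PiM (subtree N i) (\<lambda>_. borel)) (\<lambda>z. B z \<and> C z)"
      using BC(1,2) by measurable
    show "AE \<omega> in M. P \<omega> \<and> Q \<omega> \<longleftrightarrow>
        B (\<lambda>j\<in>subtree N i. inputs N j \<omega>) \<and> C (\<lambda>j\<in>subtree N i. inputs N j \<omega>)"
      using BC(3,4) by eventually_elim simp
  qed
qed

lemma local_event_not:
  assumes "local_event N i P"
  shows "local_event N i (\<lambda>\<omega>. \<not> P \<omega>)"
proof -
  obtain B where B: "Measurable.pred (PiM (subtree N i) (\<lambda>_. borel)) B"
      "AE \<omega> in M. P \<omega> \<longleftrightarrow> B (\<lambda>j\<in>subtree N i. inputs N j \<omega>)"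
    using assms unfolding local_event_def by blast
  show ?thesis
  proof (rule local_eventI)
    show "Measurable.pred M (\<lambda>\<omega>. \<not> P \<omega>)"
      using assms[THEN local_event_pred] by measurable
    show "Measurable.pred (PiM (subtree N i) (\<lambda>_. borel)) (\<lambda>z. \<not> B z)"
      using B(1) by measurable
    show "AE \<omega> in M. \<not> P \<omega> \<longleftrightarrow> \<not> B (\<lambda>j\<in>subtree N i. inputs N j \<omega>)"
      using B(2) by eventually_elim simp
  qed
qed

lemma local_event_X_gt:
  assumes "length i \<le> N"
  shows "local_event N i (\<lambda>\<omega>. ereal s < X i \<omega>)"
proof (rule local_eventI)
  obtain n where n: "length i + n = N" using assms by (metis le_add_diff_inverse)
  have [measurable]: "(\<lambda>z. fill N z i) \<in> borel_measurable (PiM (subtree N i) (\<lambda>_. borel))"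
    by (rule fill_measurable[OF n order_refl])
  show "Measurable.pred (PiM (subtree N i) (\<lambda>_. borel)) (\<lambda>z. ereal s < fill N z i)"
    by measurable
  show "AE \<omega> in M. ereal s < X i \<omega> \<longleftrightarrow> ereal s < fill N (\<lambda>j\<in>subtree N i. inputs N j \<omega>) i"
    using AE_fill_inputs[of N]
    by eventually_elim (use assms in \<open>simp add: fill_restrict[OF n order_refl]\<close>)
qed measurable

lemma reach_measurable [measurable]:
  "Measurable.pred M (\<lambda>\<omega>. reach s n i (\<lambda>j. \<tau> j \<omega>) (\<lambda>j. X j \<omega>))"
  by (induction n arbitrary: i) simp_all

lemma local_event_reach:
  assumes n: "length i + n = N"
  shows "local_event N i (\<lambda>\<omega>. reach s n i (\<lambda>j. \<tau> j \<omega>) (\<lambda>j. X j \<omega>))"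
proof (rule local_eventI)
  show "Measurable.pred (PiM (subtree N i) (\<lambda>_. borel))
      (\<lambda>z. reach s n i (\<lambda>j. real_of_ereal (z j)) (fill N z))"
    by (rule reach_fill_measurable[OF n order_refl])
  show "AE \<omega> in M. reach s n i (\<lambda>j. \<tau> j \<omega>) (\<lambda>j. X j \<omega>) \<longleftrightarrow>
      reach s n i (\<lambda>k. real_of_ereal ((\<lambda>j\<in>subtree N i. inputs N j \<omega>) k))
        (fill N (\<lambda>j\<in>subtree N i. inputs N j \<omega>))"
    using AE_fill_inputs[of N] unfolding reach_restrict[OF n order_refl]
  proof eventually_elim
    case (elim \<omega>)
    then show ?case
      using n by (intro reach_cong) (auto simp: inputs_def subtree_def)
  qed
qed measurable

text \<open>The point \<open>i\<close> and the truncated subtrees of its children are disjoint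
  blocks of one independent family; \<open>P1\<close> and \<open>P2\<close> are replaced by almost
  surely equal functions of their blocks.\<close>

lemma prob_blocks:
  assumes i: "length i < N" and A: "A \<in> sets borel"
    and 1: "local_event N (i @ [One]) P1" and 2: "local_event N (i @ [Two]) P2"
  shows "prob {\<omega> \<in> space M. \<tau> i \<omega> \<in> A \<and> P1 \<omega> \<and> P2 \<omega>} =
    prob {\<omega> \<in> space M. \<tau> i \<omega> \<in> A} * prob {\<omega> \<in> space M. P1 \<omega>} * prob {\<omega> \<in> space M. P2 \<omega>}"
proof -
  define K where "K k = (if k = 0 then {i} else if k = 1 then subtree N (i @ [One]) else subtree N (i @ [Two]))"
    for k :: nat
  have K: "K 0 = {i}" "K 1 = subtree N (i @ [One])" "K 2 = subtree N (i @ [Two])"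
    by (simp_all add: K_def)
  let ?L = "{0, 1, 2 :: nat}"
  let ?Z = "\<lambda>k \<omega>. restrict (\<lambda>j. inputs N j \<omega>) (K k)"
  have "disjoint_family_on K ?L"
    using subtree_disjoint(1)[of i N] subtree_disjoint(2)[of One Two N i] subtree_disjoint(2)[of Two One N i]
    by (auto simp: disjoint_family_on_def K_def)
  then have indep: "indep_vars (\<lambda>k. PiM (K k) (\<lambda>_. borel)) ?Z ?L"
    using i by (intro indep_vars_restrict[OF indep_inputs[of N], of ?L K])
      (auto simp: K_def subtree_def)
  obtain B1 where B1 [measurable]: "Measurable.pred (PiM (subtree N (i @ [One])) (\<lambda>_. borel)) B1"
    and P1: "AE \<omega> in M. P1 \<omega> \<longleftrightarrow> B1 (?Z 1 \<omega>)"
    using 1 unfolding local_event_def K by blast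
  obtain B2 where B2 [measurable]: "Measurable.pred (PiM (subtree N (i @ [Two])) (\<lambda>_. borel)) B2"
    and P2: "AE \<omega> in M. P2 \<omega> \<longleftrightarrow> B2 (?Z 2 \<omega>)"
    using 2 unfolding local_event_def K by blast
  define Q1 where "Q1 \<omega> = B1 (?Z 1 \<omega>)" for \<omega>
  define Q2 where "Q2 \<omega> = B2 (?Z 2 \<omega>)" for \<omega>
  note P1 = P1[folded Q1_def] and P2 = P2[folded Q2_def]
  note [measurable] = local_event_pred[OF 1] local_event_pred[OF 2] A
  define S where "S k = (if k = 0 then {f \<in> space (PiM {i} (\<lambda>_. borel)). real_of_ereal (f i) \<in> A}
      else if k = 1 then {f \<in> space (PiM (subtree N (i @ [One])) (\<lambda>_. borel)). B1 f}
      else {f \<in> space (PiM (subtree N (i @ [Two])) (\<lambda>_. borel)). B2 f})" for k :: nat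
  have S: "S k \<in> sets (PiM (K k) (\<lambda>_. borel))" for k
    unfolding S_def K_def by simp
  have Z_space: "?Z k \<omega> \<in> space (PiM (K k) (\<lambda>_. borel))" for k \<omega>
    by (simp add: space_PiM)
  have Z_measurable: "?Z k \<in> measurable M (PiM (K k) (\<lambda>_. borel))" for k
    by (intro measurable_restrict) simp
  have E: "?Z 0 -` S 0 \<inter> space M = {\<omega> \<in> space M. \<tau> i \<omega> \<in> A}"
      "?Z 1 -` S 1 \<inter> space M = {\<omega> \<in> space M. Q1 \<omega>}"
      "?Z 2 -` S 2 \<inter> space M = {\<omega> \<in> space M. Q2 \<omega>}"
    using Z_space[of _ 0] Z_space[of _ 1] Z_space[of _ 2] i
    by (auto simp: S_def K_def inputs_def Q1_def Q2_def)
  have [measurable]: "Measurable.pred M Q1" "Measurable.pred M Q2"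
    using measurable_compose[OF Z_measurable[of 1, unfolded K] B1]
      measurable_compose[OF Z_measurable[of 2, unfolded K] B2]
    by (simp_all add: K_def Q1_def[abs_def] Q2_def[abs_def])
  have "prob {\<omega> \<in> space M. \<tau> i \<omega> \<in> A \<and> P1 \<omega> \<and> P2 \<omega>} =
      prob {\<omega> \<in> space M. \<tau> i \<omega> \<in> A \<and> Q1 \<omega> \<and> Q2 \<omega>}"
    using P1 P2 by (intro measure_eq_AE) auto
  also have "\<dots> = prob (\<Inter>k\<in>?L. ?Z k -` S k \<inter> space M)"
    using E by (intro arg_cong[where f = prob]) auto
  also have "\<dots> = (\<Prod>k\<in>?L. prob (?Z k -` S k \<inter> space M))"
    using S by (intro indep_varsD[OF indep]) auto
  also have "\<dots> = prob {\<omega> \<in> space M. \<tau> i \<omega> \<in> A} * prob {\<omega> \<in> space M. Q1 \<omega>} *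
      prob {\<omega> \<in> space M. Q2 \<omega>}"
    by (simp add: E[simplified])
  also have "prob {\<omega> \<in> space M. Q1 \<omega>} = prob {\<omega> \<in> space M. P1 \<omega>}"
    using P1 by (intro measure_eq_AE) auto
  also have "prob {\<omega> \<in> space M. Q2 \<omega>} = prob {\<omega> \<in> space M. P2 \<omega>}"
    using P2 by (intro measure_eq_AE) auto
  finally show ?thesis .
qed

section \<open>Tail and survival probabilities\<close>

definition tail :: "real \<Rightarrow> real" where
  "tail s = prob {\<omega> \<in> space M. ereal s < X [] \<omega>}"

lemma measure_\<mu>: "measure \<mu> {x \<in> I_set. ereal s < x} = prob {\<omega> \<in> space M. ereal s < X i \<omega>}"
proof -
  have "{x \<in> space I_space. ereal s < x} \<in> sets I_space" by measurable
  then have "measure (distr M I_space (X i)) {x \<in> I_set. ereal s < x} =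
      prob (X i -` {x \<in> I_set. ereal s < x} \<inter> space M)"
    by (intro measure_distr) auto
  also have "X i -` {x \<in> I_set. ereal s < x} \<inter> space M = {\<omega> \<in> space M. ereal s < X i \<omega>}"
    using measurable_space[OF X_measurable] by auto
  finally show ?thesis by (simp add: distr_X_level[OF refl])
qed

lemma prob_X_gt: "prob {\<omega> \<in> space M. ereal s < X i \<omega>} = tail s"
  unfolding tail_def by (metis measure_\<mu>)

lemma prob_\<tau>_le:
  assumes "0 \<le> s" "s \<le> 1"
  shows "prob {\<omega> \<in> space M. \<tau> i \<omega> \<le> s} = s"
proof -
  have "prob {\<omega> \<in> space M. \<tau> i \<omega> \<le> s} = measure (distr M borel (\<tau> i)) {..s}"
    by (subst measure_distr) (auto intro!: arg_cong[where f = prob])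
  also have "emeasure unif01 {..s} = emeasure lborel ({0..1} \<inter> {..s})"
    by (simp add: unif01_def divide_ennreal_def)
  then have "measure (distr M borel (\<tau> i)) {..s} = measure lborel ({0..1} \<inter> {..s})"
    unfolding distr_\<tau> by (simp add: measure_def)
  also have "{0..1} \<inter> {..s} = {0..s}" using assms by auto
  finally show ?thesis using assms by simp
qed

lemma prob_step:
  assumes "length i < N" "0 \<le> s" "s \<le> 1"
    and "local_event N (i @ [One]) P1" "local_event N (i @ [Two]) P2"
  shows "prob {\<omega> \<in> space M. \<tau> i \<omega> \<le> s \<and> P1 \<omega> \<and> P2 \<omega>} =
    s * prob {\<omega> \<in> space M. P1 \<omega>} * prob {\<omega> \<in> space M. P2 \<omega>}"
  using prob_blocks[OF assms(1) _ assms(4,5), of "{..s}"] prob_\<tau>_le[OF assms(2,3), of i] by simp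

text \<open>A root value in \<open>(r, s]\<close> is finite, so it is the minimum over the children
  and exceeds the time at the root, which is therefore at most \<open>s\<close>. Keeping only this
  bound on the time makes the result an inequality.\<close>

lemma tail_RDE:
  assumes "r \<le> s" "0 \<le> s" "s \<le> 1"
  shows "tail r - tail s \<le> s * ((tail r)\<^sup>2 - (tail s)\<^sup>2)"
proof -
  let ?E = "\<lambda>u. {\<omega> \<in> space M. \<tau> [] \<omega> \<le> s \<and> ereal u < X ([] @ [One]) \<omega> \<and> ereal u < X ([] @ [Two]) \<omega>}"
  have E: "prob (?E u) = s * (tail u)\<^sup>2" for u
    using assms by (subst prob_step[where N = 1])
      (auto intro!: local_event_X_gt simp: prob_X_gt power2_eq_square)
  have "tail r - tail s = prob ({\<omega> \<in> space M. ereal r < X [] \<omega>} - {\<omega> \<in> space M. ereal s < X [] \<omega>})"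
    unfolding tail_def using assms
    by (intro finite_measure_Diff[symmetric]) (auto intro: order.strict_trans1[of _ "ereal s"])
  also have "\<dots> \<le> prob (?E r - ?E s)"
  proof (rule finite_measure_mono_AE)
    show "AE \<omega> in M. \<omega> \<in> {\<omega> \<in> space M. ereal r < X [] \<omega>} - {\<omega> \<in> space M. ereal s < X [] \<omega>} \<longrightarrow>
        \<omega> \<in> ?E r - ?E s"
      using AE_X_recursion
    proof eventually_elim
      case (elim \<omega>)
      show ?case
      proof
        assume \<omega>: "\<omega> \<in> {\<omega> \<in> space M. ereal r < X [] \<omega>} - {\<omega> \<in> space M. ereal s < X [] \<omega>}"
        then have "X [] \<omega> \<noteq> \<infinity>" by auto
        with elim[rule_format, of "[]"]
        have *: "X [] \<omega> = min (X ([] @ [One]) \<omega>) (X ([] @ [Two]) \<omega>)" "ereal (\<tau> [] \<omega>) < X [] \<omega>"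
          by (auto simp: gamma_map_def split: if_splits)
        moreover have "ereal (\<tau> [] \<omega>) \<le> ereal s"
          using \<omega> order.strict_trans2[OF *(2), of "ereal s"] by (simp add: not_less)
        ultimately show "\<omega> \<in> ?E r - ?E s" using \<omega> by auto
      qed
    qed
  qed measurable
  also have "\<dots> = prob (?E r) - prob (?E s)"
    using assms by (intro finite_measure_Diff) (auto intro: order.strict_trans1[of _ "ereal s"])
  also have "\<dots> = s * ((tail r)\<^sup>2 - (tail s)\<^sup>2)"
    unfolding E by (simp add: algebra_simps)
  finally show ?thesis .
qed

text \<open>At an open point with both children above \<open>s\<close>, survival fails only if
  neither child survives; subtracting this product event gives one step of
  \<open>survival\<close>.\<close>

lemma prob_reach:
  assumes s: "0 \<le> s" "s \<le> 1"
  shows "prob {\<omega> \<in> space M. reach s n i (\<lambda>j. \<tau> j \<omega>) (\<lambda>j. X j \<omega>)} = survival s (tail s) n"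
proof (induction n arbitrary: i)
  case 0
  then show ?case by (simp add: prob_X_gt)
next
  case (Suc n)
  let ?R = "\<lambda>a \<omega>. reach s n (i @ [a]) (\<lambda>j. \<tau> j \<omega>) (\<lambda>j. X j \<omega>)"
  let ?B = "\<lambda>a \<omega>. ereal s < X (i @ [a]) \<omega>"
  let ?N = "length i + Suc n"
  have B: "local_event ?N (i @ [a]) (?B a)" for a
    by (rule local_event_X_gt) simp
  have BR: "local_event ?N (i @ [a]) (\<lambda>\<omega>. ?B a \<omega> \<and> \<not> ?R a \<omega>)" for a
    by (intro local_event_conj local_event_not B local_event_reach) simp
  \<comment> \<open>By \<open>reach_value_gt\<close>, a surviving child almost surely has a value
    above \<open>s\<close>, so the probabilities subtract.\<close>
  have diff: "prob {\<omega> \<in> space M. ?B a \<omega> \<and> \<not> ?R a \<omega>} = tail s - survival s (tail s) n" for a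
  proof -
    have "prob {\<omega> \<in> space M. ?B a \<omega> \<and> \<not> ?R a \<omega>} =
        prob ({\<omega> \<in> space M. ?B a \<omega>} - {\<omega> \<in> space M. ?B a \<omega> \<and> ?R a \<omega>})"
      by (intro arg_cong[where f = prob]) auto
    also have "\<dots> = prob {\<omega> \<in> space M. ?B a \<omega>} - prob {\<omega> \<in> space M. ?B a \<omega> \<and> ?R a \<omega>}"
      by (intro finite_measure_Diff) auto
    also have "prob {\<omega> \<in> space M. ?B a \<omega> \<and> ?R a \<omega>} = prob {\<omega> \<in> space M. ?R a \<omega>}"
    proof (rule measure_eq_AE)
      show "AE \<omega> in M. \<omega> \<in> {\<omega> \<in> space M. ?B a \<omega> \<and> ?R a \<omega>} \<longleftrightarrow> \<omega> \<in> {\<omega> \<in> space M. ?R a \<omega>}"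
        using AE_X_recursion
      proof eventually_elim
        case (elim \<omega>)
        from reach_value_gt[of "\<lambda>i. X i \<omega>" "\<lambda>i. \<tau> i \<omega>" s n "i @ [a]", OF elim[rule_format]]
        show ?case by auto
      qed
    qed measurable
    finally show ?thesis by (simp add: Suc prob_X_gt)
  qed
  have "prob {\<omega> \<in> space M. reach s (Suc n) i (\<lambda>j. \<tau> j \<omega>) (\<lambda>j. X j \<omega>)} =
      prob ({\<omega> \<in> space M. \<tau> i \<omega> \<le> s \<and> ?B One \<omega> \<and> ?B Two \<omega>} -
        {\<omega> \<in> space M. \<tau> i \<omega> \<le> s \<and> (?B One \<omega> \<and> \<not> ?R One \<omega>) \<and> (?B Two \<omega> \<and> \<not> ?R Two \<omega>)})"
    by (intro arg_cong[where f = prob]) auto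
  also have "\<dots> = prob {\<omega> \<in> space M. \<tau> i \<omega> \<le> s \<and> ?B One \<omega> \<and> ?B Two \<omega>} -
      prob {\<omega> \<in> space M. \<tau> i \<omega> \<le> s \<and> (?B One \<omega> \<and> \<not> ?R One \<omega>) \<and> (?B Two \<omega> \<and> \<not> ?R Two \<omega>)}"
    by (intro finite_measure_Diff) auto
  also have "\<dots> = s * tail s * tail s -
      s * (tail s - survival s (tail s) n) * (tail s - survival s (tail s) n)"
    by (subst (1 2) prob_step[where N = ?N]) (use s B BR diff in \<open>auto simp: prob_X_gt\<close>)
  finally show ?case by (simp add: algebra_simps power2_eq_square)
qed

lemma tail_bounds: "0 \<le> tail s" "tail s \<le> 1"
  by (simp_all add: tail_def)

lemma tail_mono: "r \<le> s \<Longrightarrow> tail s \<le> tail r"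
  unfolding tail_def by (intro finite_measure_mono) (auto intro: order.strict_trans1[of _ "ereal s"])

lemma tail_neg: "tail (-1) = 1"
proof -
  have "ereal (-1) < X [] \<omega>" if "\<omega> \<in> space M" for \<omega>
    using measurable_space[OF X_measurable[of "[]"] that]
    by (auto simp: I_set_def intro: order.strict_trans2[of _ 0])
  then have "{\<omega> \<in> space M. ereal (-1) < X [] \<omega>} = space M" by blast
  then show ?thesis by (simp only: tail_def prob_space)
qed

section \<open>Almost sure equality and the law \<nu>\<close>

lemma AE_no_path_iff:
  assumes s: "0 \<le> s" "s \<le> 1"
  shows "(AE \<omega> in M. \<not> (\<forall>n. reach s n [] (\<lambda>j. \<tau> j \<omega>) (\<lambda>j. X j \<omega>))) \<longleftrightarrow> 2 * s * tail s \<le> 1"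
proof -
  let ?R = "\<lambda>n \<omega>. reach s n [] (\<lambda>j. \<tau> j \<omega>) (\<lambda>j. X j \<omega>)"
  \<comment> \<open>Survival is antitone in the depth only almost surely; asking for all smaller
    depths makes the events decrease everywhere, as continuity from above requires.\<close>
  let ?E = "\<lambda>n. {\<omega> \<in> space M. \<forall>m\<le>n. ?R m \<omega>}"
  have "(\<lambda>n. prob (?E n)) \<longlonglongrightarrow> prob (\<Inter>n. ?E n)"
    by (intro finite_Lim_measure_decseq) (auto simp: decseq_def)
  moreover have "(\<Inter>n. ?E n) = {\<omega> \<in> space M. \<forall>n. ?R n \<omega>}" by auto
  moreover have "prob (?E n) = survival s (tail s) n" for n
  proof -
    have "prob (?E n) = prob {\<omega> \<in> space M. ?R n \<omega>}"
    proof (rule measure_eq_AE)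
      show "AE \<omega> in M. \<omega> \<in> ?E n \<longleftrightarrow> \<omega> \<in> {\<omega> \<in> space M. ?R n \<omega>}"
        using AE_X_recursion
      proof eventually_elim
        case (elim \<omega>)
        from reach_antimono[of "\<lambda>i. X i \<omega>" "\<lambda>i. \<tau> i \<omega>" _ n s "[]", OF elim[rule_format]]
        show ?case by auto
      qed
    qed measurable
    then show ?thesis by (simp add: prob_reach[OF s])
  qed
  ultimately have "survival s (tail s) \<longlonglongrightarrow> prob {\<omega> \<in> space M. \<forall>n. ?R n \<omega>}" by simp
  from survival_limit_eq_0_iff[OF tail_bounds s this measure_nonneg]
  have "prob {\<omega> \<in> space M. \<forall>n. ?R n \<omega>} = 0 \<longleftrightarrow> 2 * s * tail s \<le> 1" .
  moreover have "prob {\<omega> \<in> space M. \<forall>n. ?R n \<omega>} = 0 \<longleftrightarrow> (AE \<omega> in M. \<not> (\<forall>n. ?R n \<omega>))"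
    by (subst prob_eq_0) auto
  ultimately show ?thesis by simp
qed

lemma AE_X_up_eq_iff:
  "(AE \<omega> in M. X_up (\<lambda>i. \<tau> i \<omega>) (\<lambda>i. X i \<omega>) [] = X [] \<omega>) \<longleftrightarrow>
   (\<forall>s. 0 \<le> s \<longrightarrow> s \<le> 1 \<longrightarrow> 2 * s * tail s \<le> 1)"
proof -
  let ?P = "\<lambda>s \<omega>. \<forall>n. reach s n [] (\<lambda>j. \<tau> j \<omega>) (\<lambda>j. X j \<omega>)"
  have X_in: "X [] \<omega> \<in> I_set" if "\<omega> \<in> space M" for \<omega>
    using measurable_space[OF X_measurable that] by simp
  have "(AE \<omega> in M. X_up (\<lambda>i. \<tau> i \<omega>) (\<lambda>i. X i \<omega>) [] = X [] \<omega> \<longleftrightarrow>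
      (\<forall>s. 0 \<le> s \<longrightarrow> s \<le> 1 \<longrightarrow> \<not> ?P s \<omega>))"
    using AE_X_recursion AE_space
  proof eventually_elim
    case (elim \<omega>)
    show ?case
      by (rule X_up_eq_iff[of "\<lambda>i. X i \<omega>" "\<lambda>i. \<tau> i \<omega>", OF elim(1)[rule_format] X_in[OF elim(2)]])
  qed
  then have "(AE \<omega> in M. X_up (\<lambda>i. \<tau> i \<omega>) (\<lambda>i. X i \<omega>) [] = X [] \<omega>) \<longleftrightarrow>
      (AE \<omega> in M. \<forall>s. 0 \<le> s \<longrightarrow> s \<le> 1 \<longrightarrow> \<not> ?P s \<omega>)"
    by (rule eventually_subst)
  \<comment> \<open>Moving the uncountable quantifier inside the almost sure statement goes through
    rational times, by \<open>ex_rational_reach\<close>.\<close>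
  also have "\<dots> \<longleftrightarrow> (\<forall>s. 0 \<le> s \<longrightarrow> s \<le> 1 \<longrightarrow> (AE \<omega> in M. \<not> ?P s \<omega>))"
  proof (intro iffI allI impI)
    fix s :: real
    assume *: "AE \<omega> in M. \<forall>s. 0 \<le> s \<longrightarrow> s \<le> 1 \<longrightarrow> \<not> ?P s \<omega>" and s: "0 \<le> s" "s \<le> 1"
    from * show "AE \<omega> in M. \<not> ?P s \<omega>" by eventually_elim (use s in blast)
  next
    assume *: "\<forall>s. 0 \<le> s \<longrightarrow> s \<le> 1 \<longrightarrow> (AE \<omega> in M. \<not> ?P s \<omega>)"
    have "AE \<omega> in M. \<forall>r :: rat. 0 \<le> real_of_rat r \<longrightarrow> real_of_rat r \<le> 1 \<longrightarrow> \<not> ?P (of_rat r) \<omega>"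
      unfolding AE_all_countable using * by (auto simp del: zero_le_of_rat_iff of_rat_le_1_iff)
    then show "AE \<omega> in M. \<forall>s. 0 \<le> s \<longrightarrow> s \<le> 1 \<longrightarrow> \<not> ?P s \<omega>"
      using AE_X_recursion
    proof eventually_elim
      case (elim \<omega>)
      show ?case
      proof (intro allI impI notI)
        fix s :: real assume "0 \<le> s" "s \<le> 1" "?P s \<omega>"
        from ex_rational_reach[of "\<lambda>i. X i \<omega>" "\<lambda>i. \<tau> i \<omega>", OF elim(2)[rule_format] this]
          elim(1) show False by blast
      qed
    qed
  qed
  also have "\<dots> \<longleftrightarrow> (\<forall>s. 0 \<le> s \<longrightarrow> s \<le> 1 \<longrightarrow> 2 * s * tail s \<le> 1)"
    using AE_no_path_iff by blast
  finally show ?thesis .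
qed

lemma law_on_I_\<mu>: "law_on_I \<mu>"
  using prob_space_distr[OF X_measurable[of "[]"]] distr_X_level[of "[]" 0]
  by (auto simp: law_on_I_def)

lemma emeasure_\<mu>_tail:
  assumes "0 \<le> s"
  shows "emeasure \<mu> ({ereal s<..1} \<union> {\<infinity>}) = ennreal (tail s)"
proof -
  interpret \<mu>: prob_space \<mu> using law_on_I_\<mu> by (simp add: law_on_I_def)
  have "{ereal s<..1} \<union> {\<infinity>} = {x \<in> I_set. ereal s < x}"
    using tail_set_eq[OF assms] by auto
  then show ?thesis by (simp only: \<mu>.emeasure_eq_measure measure_\<mu>[of s "[]"] tail_def)
qed

lemma \<mu>_eq_nu_iff: "\<mu> = nu \<longleftrightarrow> (\<forall>s. 0 \<le> s \<longrightarrow> s \<le> 1 \<longrightarrow> 2 * s * tail s \<le> 1)"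
proof (intro iffI allI impI)
  fix s :: real
  assume "\<mu> = nu" and s: "0 \<le> s" "s \<le> 1"
  show "2 * s * tail s \<le> 1"
  proof (cases "s = 0")
    case False
    with s have "0 < s" by simp
    have "ennreal (tail s) = ennreal (min 1 (1 / (2 * s)))"
      using has_nu_tails_nu s emeasure_\<mu>_tail[OF s(1)]
      unfolding \<open>\<mu> = nu\<close> has_nu_tails_def nu_tail_eq[OF \<open>0 < s\<close>, symmetric] by metis
    then have "tail s \<le> 1 / (2 * s)"
      using s tail_bounds by (subst (asm) ennreal_inj) auto
    then show ?thesis using \<open>0 < s\<close> by (simp add: field_simps)
  qed simp
next
  assume *: "\<forall>s. 0 \<le> s \<longrightarrow> s \<le> 1 \<longrightarrow> 2 * s * tail s \<le> 1"
  note det = tail_determined[of tail, OF tail_mono tail_bounds(2,1) tail_neg tail_RDE *[rule_format]]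
  have "emeasure \<mu> ({ereal s<..1} \<union> {\<infinity>}) = min 1 (1 / ennreal (2 * s))" if s: "0 \<le> s" "s \<le> 1" for s
  proof (cases "s = 0")
    \<comment> \<open>In \<open>ennreal\<close> the right-hand side at 0 is
      \<open>min 1 \<infinity>\<close>, so the claim is \<open>tail 0 = 1\<close>.\<close>
    case True
    then show ?thesis using emeasure_\<mu>_tail[of 0] det(1) by simp
  next
    case False
    with s have "0 < s" by simp
    then show ?thesis unfolding emeasure_\<mu>_tail[OF s(1)] nu_tail_eq[OF \<open>0 < s\<close>]
      using det(2)[of s] s by simp
  qed
  then have "has_nu_tails \<mu>" using law_on_I_\<mu> by (simp add: has_nu_tails_def)
  then show "\<mu> = nu" by (rule has_nu_tails_unique[OF _ has_nu_tails_nu])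
qed

end

theorem theorem6:
  fixes M :: "'a measure" and \<mu> :: "ereal measure"
    and \<tau> :: "tree_word \<Rightarrow> 'a \<Rightarrow> real" and X :: "tree_word \<Rightarrow> 'a \<Rightarrow> ereal"
  assumes "RDE_solution \<mu>"
    and "recursive_tree_process M \<mu> \<tau> X"
  shows "(AE \<omega> in M. X_up (\<lambda>i. \<tau> i \<omega>) (\<lambda>i. X i \<omega>) [] = X [] \<omega>) \<longleftrightarrow> \<mu> = nu"
proof -
  interpret tree_process M \<mu> \<tau> X
    by unfold_locales fact
  show ?thesis
    unfolding AE_X_up_eq_iff \<mu>_eq_nu_iff ..
qed

end
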